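(* Let $(\mathcal T,\preceq)$ be a rooted non-metric tree. For each $t\in\mathcal T$, let $\preceq_t$ be the order on $\mathcal T$ defined by $a\preceq_t b$ if and only if $a\in[t,b]$, and let $\mathfrak S_t$ be the Scott topology on the partially ordered set $(\mathcal T,\preceq_t)$. Then the weak tree topology on $\mathcal T$ is the topology generated by $\bigcup_{t\in\mathcal T}\mathfrak S_t$.
   Context: A rooted non-metric tree is a partially ordered set $(\mathcal T,\preceq)$ such that: (T1) there exists a (unique) smallest element $t_0\in\mathcal T$ (the root); (T2) for every $t\in\mathcal T$ the set $I_t=\{a\in\mathcal T\mid a\preceq t\}$ is isomorphic, as an ordered set, to a real interval; (T3) every totally ordered convex subset of $\mathcal T$ is isomorphic, as an ordered set, to a real interval; (T4) every non-empty subset of $\mathcal T$ admits an infimum in $\mathcal T$. Here real intervals may be degenerate (a single point or empty), and a subset $C$ is convex if $x,y\in C$ and $x\preceq z\preceq y$ imply $z\in C$. For $a,b\in\mathcal T$ let $a\wedge b$ denote the infimum of $\{a,b\}$ with respect to $\preceq$, and define the closed segment $$[a,b]:=\{c\in\mathcal T\mid (a\wedge b\preceq c\preceq a)\text{ or }(a\wedge b\preceq c\preceq b)\}.$$ For $t\in\mathcal T$ define an equivalence relation on $\mathcal T\setminus\{t\}$ by $a\sim_t b$ if and only if $t\notin[a,b]$, and for $a\in\mathcal T\setminus\{t\}$ let $[a]_t$ be the equivalence class of $a$ under $\sim_t$. The weak tree topology on $\mathcal T$ is the topology generated (as a subbasis) by all sets $[a]_t$ with $a,t\in\mathcal T$,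 $a\neq t$. For each $t\in\mathcal T$, the relation $\preceq_t$ is a partial order for which $(\mathcal T,\preceq_t)$ is a rooted non-metric tree with root $t$ having the same closed segments as $(\mathcal T,\preceq)$. For a partially ordered set $(\mathcal P,\leq)$, a subset $\mathcal S$ is an upper set if $x\in\mathcal S$, $y\in\mathcal P$ and $x\leq y$ imply $y\in\mathcal S$. It is inaccessible by directed joins if for every (non-empty, upward) directed subset $\mathcal D\subseteq\mathcal P$ whose supremum exists and lies in $\mathcal S$, one has $\mathcal D\cap\mathcal S\neq\emptyset$. The Scott topology on $\mathcal P$ is the topology whose open sets are exactly the upper sets that are inaccessible by directed joins. *)

theory Defs
  imports "HOL-Algebra.Lattice" "HOL-Analysis.Analysis"
begin

text \<open>
  Posets are the carrier-based partial orders of \<^locale>\<open>partial_order\<close>, so that suprema and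
  infima are taken in the carrier of the poset under consideration.
\<close>

definition iso_real_interval :: "('a, 'b) gorder_scheme \<Rightarrow> 'a set \<Rightarrow> bool" where
  "iso_real_interval P A \<longleftrightarrow>
     (\<exists>(J :: real set) f. is_interval J \<and> bij_betw f A J \<and>
        (\<forall>x\<in>A. \<forall>y\<in>A. x \<sqsubseteq>\<^bsub>P\<^esub> y \<longleftrightarrow> f x \<le> f y))"

definition order_convex :: "('a, 'b) gorder_scheme \<Rightarrow> 'a set \<Rightarrow> bool" where
  "order_convex P C \<longleftrightarrow>
     C \<subseteq> carrier P \<and>
     (\<forall>x\<in>C. \<forall>y\<in>C. \<forall>z\<in>carrier P. x \<sqsubseteq>\<^bsub>P\<^esub> z \<and> z \<sqsubseteq>\<^bsub>P\<^esub> y \<longrightarrow> z \<in> C)"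

locale rooted_nonmetric_tree = partial_order T for T (structure) +
  assumes T1: "\<exists>t\<^sub>0. least T t\<^sub>0 (carrier T)"
    and T2: "\<And>t. t \<in> carrier T \<Longrightarrow> iso_real_interval T {a \<in> carrier T. a \<sqsubseteq> t}"
    and T3: "\<And>C. order_convex T C \<Longrightarrow> (\<And>x y. x \<in> C \<Longrightarrow> y \<in> C \<Longrightarrow> x \<sqsubseteq> y \<or> y \<sqsubseteq> x) \<Longrightarrow>
               iso_real_interval T C"
    and T4: "\<And>S. S \<subseteq> carrier T \<Longrightarrow> S \<noteq> {} \<Longrightarrow> \<exists>i. is_glb T i S"

definition segment :: "('a, 'b) gorder_scheme \<Rightarrow> 'a \<Rightarrow> 'a \<Rightarrow> 'a set" where
  "segment T a b =
     {c \<in> carrier T. (a \<sqinter>\<^bsub>T\<^esub> b \<sqsubseteq>\<^bsub>T\<^esub> c \<and> c \<sqsubseteq>\<^bsub>T\<^esub> a) \<or> (a \<sqinter>\<^bsub>T\<^esub> b \<sqsubseteq>\<^bsub>T\<^esub> c \<and> c \<sqsubseteq>\<^bsub>T\<^esub> b)}"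

definition tree_equiv :: "('a, 'b) gorder_scheme \<Rightarrow> 'a \<Rightarrow> ('a \<times> 'a) set" where
  "tree_equiv T t =
     {(a, b). a \<in> carrier T - {t} \<and> b \<in> carrier T - {t} \<and> t \<notin> segment T a b}"

text \<open>
  The topology on \<open>X\<close> with subbasis \<open>\<S>\<close>. Adding \<open>X\<close> accounts for the empty intersection:
  otherwise the space would be only \<open>\<Union>\<S>\<close>, which is empty for the subbasis below when the tree
  is a single point.
\<close>

definition topology_on_generated_by :: "'a set \<Rightarrow> 'a set set \<Rightarrow> 'a topology" where
  "topology_on_generated_by X \<S> = topology_generated_by (insert X \<S>)"

definition weak_tree_topology :: "('a, 'b) gorder_scheme \<Rightarrow> 'a topology" where
  "weak_tree_topology T =
     topology_on_generated_by (carrier T)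
       {tree_equiv T t `` {a} | a t. a \<in> carrier T \<and> t \<in> carrier T \<and> a \<noteq> t}"

definition order_from :: "('a, 'b) gorder_scheme \<Rightarrow> 'a \<Rightarrow> 'a gorder" where
  "order_from T t = \<lparr>carrier = carrier T, eq = (=), le = (\<lambda>a b. a \<in> segment T t b)\<rparr>"

definition upper_set :: "('a, 'b) gorder_scheme \<Rightarrow> 'a set \<Rightarrow> bool" where
  "upper_set P S \<longleftrightarrow>
     S \<subseteq> carrier P \<and> (\<forall>x\<in>S. \<forall>y\<in>carrier P. x \<sqsubseteq>\<^bsub>P\<^esub> y \<longrightarrow> y \<in> S)"

definition directed_set :: "('a, 'b) gorder_scheme \<Rightarrow> 'a set \<Rightarrow> bool" where
  "directed_set P D \<longleftrightarrow>
     D \<subseteq> carrier P \<and> D \<noteq> {} \<and> (\<forall>x\<in>D. \<forall>y\<in>D. \<exists>z\<in>D. x \<sqsubseteq>\<^bsub>P\<^esub> z \<and> y \<sqsubseteq>\<^bsub>P\<^esub> z)"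

definition inaccessible_by_directed_joins :: "('a, 'b) gorder_scheme \<Rightarrow> 'a set \<Rightarrow> bool" where
  "inaccessible_by_directed_joins P S \<longleftrightarrow>
     (\<forall>D s. directed_set P D \<and> is_lub P s D \<and> s \<in> S \<longrightarrow> D \<inter> S \<noteq> {})"

definition scott_open :: "('a, 'b) gorder_scheme \<Rightarrow> 'a set \<Rightarrow> bool" where
  "scott_open P S \<longleftrightarrow> upper_set P S \<and> inaccessible_by_directed_joins P S"

definition scott_topology :: "('a, 'b) gorder_scheme \<Rightarrow> 'a topology" where
  "scott_topology P = topology (scott_open P)"

lemma istopology_scott_open: "istopology (scott_open P)"
  unfolding istopology_def
proof (intro conjI allI impI)
  fix S S' assume S: "scott_open P S" and S': "scott_open P S'"
  have up: "upper_set P S" "upper_set P S'"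
    and inacc: "inaccessible_by_directed_joins P S" "inaccessible_by_directed_joins P S'"
    using S S' by (simp_all add: scott_open_def)
  have "inaccessible_by_directed_joins P (S \<inter> S')"
    unfolding inaccessible_by_directed_joins_def
  proof (intro allI impI)
    fix D s assume D: "directed_set P D \<and> is_lub P s D \<and> s \<in> S \<inter> S'"
    have "D \<inter> S \<noteq> {}" "D \<inter> S' \<noteq> {}"
      using inacc D by (simp_all add: inaccessible_by_directed_joins_def, metis+)
    then obtain d d' where d: "d \<in> D" "d \<in> S" "d' \<in> D" "d' \<in> S'" by blast
    obtain e where e: "e \<in> D" "d \<sqsubseteq>\<^bsub>P\<^esub> e" "d' \<sqsubseteq>\<^bsub>P\<^esub> e" "e \<in> carrier P"
      using D d unfolding directed_set_def by (meson subsetD)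
    have "e \<in> S" "e \<in> S'"
      using up d e by (simp_all add: upper_set_def)
    then show "D \<inter> (S \<inter> S') \<noteq> {}" using e(1) by blast
  qed
  moreover have "upper_set P (S \<inter> S')"
    using up by (auto simp: upper_set_def)
  ultimately show "scott_open P (S \<inter> S')"
    by (simp add: scott_open_def)
next
  fix \<K> assume K: "\<forall>K\<in>\<K>. scott_open P K"
  have "upper_set P (\<Union>\<K>)"
    using K unfolding scott_open_def upper_set_def by (meson Union_iff Sup_least)
  moreover have "inaccessible_by_directed_joins P (\<Union>\<K>)"
    unfolding inaccessible_by_directed_joins_def
  proof (intro allI impI)
    fix D s assume D: "directed_set P D \<and> is_lub P s D \<and> s \<in> \<Union>\<K>"
    then obtain K where "K \<in> \<K>" "s \<in> K" by blast
    then have "D \<inter> K \<noteq> {}"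
      using K D by (simp add: scott_open_def inaccessible_by_directed_joins_def, metis)
    then show "D \<inter> \<Union>\<K> \<noteq> {}" using \<open>K \<in> \<K>\<close> by blast
  qed
  ultimately show "scott_open P (\<Union>\<K>)"
    by (simp add: scott_open_def)
qed

lemma openin_scott_topology: "openin (scott_topology P) S \<longleftrightarrow> scott_open P S"
  by (simp add: scott_topology_def istopology_scott_open)

end

theory Submission
  imports Defs
begin

text \<open>
  A class \<open>[a]\<^sub>t\<close> is itself Scott open for \<open>\<preceq>\<^sub>t\<close>: everything \<open>\<preceq>\<^sub>t\<close>-comparable to a
  point \<open>x \<noteq> t\<close> and different from \<open>t\<close> lies on the same side of \<open>t\<close> as \<open>x\<close>. Conversely, for
  \<open>s \<noteq> t\<close> the half-open segment \<open>[t, s)\<close> is directed with supremum \<open>s\<close>, so a Scott open \<open>U\<close>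
  containing \<open>s\<close> contains some \<open>d\<close> in \<open>[t, s)\<close>, and then \<open>[s]\<^sub>d \<subseteq> U\<close> because every point of
  \<open>[s]\<^sub>d\<close> lies \<open>\<preceq>\<^sub>t\<close>-above \<open>d\<close>.
\<close>

text \<open>A generated topology is the coarsest one in which its subbasis is open, so each
  inclusion can be checked on the subbasis. The inserted \<open>X\<close> is a subbasis member on
  both sides.\<close>

lemma topology_on_generated_by_eqI:
  assumes "\<And>U. U \<in> \<A> \<Longrightarrow> openin (topology_on_generated_by X \<B>) U"
    and "\<And>U. U \<in> \<B> \<Longrightarrow> openin (topology_on_generated_by X \<A>) U"
  shows "topology_on_generated_by X \<A> = topology_on_generated_by X \<B>"
proof -
  have sub: "openin (topology_on_generated_by X \<D>) U"
    if "\<And>V. V \<in> \<C> \<Longrightarrow> openin (topology_on_generated_by X \<D>) V"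
      and "openin (topology_on_generated_by X \<C>) U" for \<C> \<D> U
  proof (rule generate_topology_on_coarsest)
    show "generate_topology_on (insert X \<C>) U"
      using that(2) by (simp add: topology_on_generated_by_def openin_topology_generated_by_iff)
    show "openin (topology_on_generated_by X \<D>) V" if "V \<in> insert X \<C>" for V
      using that \<open>\<And>V. V \<in> \<C> \<Longrightarrow> openin (topology_on_generated_by X \<D>) V\<close>
      by (auto simp: topology_on_generated_by_def intro: topology_generated_by_Basis)
  qed simp
  show ?thesis
    unfolding topology_eq using sub assms by blast
qed

section \<open>Meets, linearity of down-sets and density\<close>

context rooted_nonmetric_tree
begin

text \<open>\<open>meet\<close> is a choice operator; T4 provides a witness, so the chosen element
  really is an infimum.\<close>

lemma meet_is_glb:
  assumes "a \<in> carrier T" "b \<in> carrier T"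
  shows "is_glb T (a \<sqinter> b) {a, b}"
proof -
  have "\<exists>i. is_glb T i {a, b}" using T4[of "{a, b}"] assms by simp
  then show ?thesis unfolding meet_def inf_def by (rule someI_ex)
qed

lemma
  assumes "a \<in> carrier T" "b \<in> carrier T"
  shows tree_meet_closed: "a \<sqinter> b \<in> carrier T"
    and tree_meet_left: "a \<sqinter> b \<sqsubseteq> a"
    and tree_meet_right: "a \<sqinter> b \<sqsubseteq> b"
    and tree_meet_greatest: "\<And>c. c \<in> carrier T \<Longrightarrow> c \<sqsubseteq> a \<Longrightarrow> c \<sqsubseteq> b \<Longrightarrow> c \<sqsubseteq> a \<sqinter> b"
  using meet_is_glb[OF assms] assms by (auto simp: greatest_def Lower_def)

lemma down_set_total:
  assumes "x \<in> carrier T" "y \<in> carrier T" "t \<in> carrier T" "x \<sqsubseteq> t" "y \<sqsubseteq> t"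
  shows "x \<sqsubseteq> y \<or> y \<sqsubseteq> x"
proof -
  obtain f :: "'a \<Rightarrow> real" where
    "\<forall>x\<in>{a \<in> carrier T. a \<sqsubseteq> t}. \<forall>y\<in>{a \<in> carrier T. a \<sqsubseteq> t}. x \<sqsubseteq> y \<longleftrightarrow> f x \<le> f y"
    using T2[OF assms(3)] unfolding iso_real_interval_def by blast
  then show ?thesis using assms linear[of "f x" "f y"] by blast
qed

text \<open>Under the isomorphism of T2, \<open>c\<close> is the preimage of the midpoint of the
  images of \<open>x\<close> and \<open>y\<close>, which lies in the interval by convexity.\<close>

lemma tree_dense:
  assumes "x \<in> carrier T" "y \<in> carrier T" "x \<sqsubseteq> y" "x \<noteq> y"
  obtains c where "c \<in> carrier T" "x \<sqsubseteq> c" "c \<sqsubseteq> y" "\<not> c \<sqsubseteq> x" "c \<noteq> y"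
proof -
  let ?A = "{a \<in> carrier T. a \<sqsubseteq> y}"
  obtain J :: "real set" and f where J: "is_interval J" and f: "bij_betw f ?A J"
    and ord: "\<forall>x\<in>?A. \<forall>y\<in>?A. x \<sqsubseteq> y \<longleftrightarrow> f x \<le> f y"
    using T2[OF assms(2)] unfolding iso_real_interval_def by blast
  have A: "x \<in> ?A" "y \<in> ?A" using assms by auto
  have "f x \<in> J" "f y \<in> J" using A f by (auto dest: bij_betwE)
  moreover have "f x < f y"
  proof -
    have "f x \<noteq> f y"
      using inj_onD[OF bij_betw_imp_inj_on[OF f] _ A] assms(4) by blast
    moreover have "f x \<le> f y"
      using ord A assms(3) by blast
    ultimately show ?thesis by simp
  qed
  ultimately have "(f x + f y) / 2 \<in> J"
    using mem_is_interval_1_I[OF J, of "f x" "f y" "(f x + f y) / 2"] by auto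
  then have "(f x + f y) / 2 \<in> f ` ?A"
    using bij_betw_imp_surj_on[OF f] by simp
  then obtain c where c: "(f x + f y) / 2 = f c" and cA: "c \<in> ?A"
    by (rule imageE)
  then show thesis
  proof (intro that[of c])
    show "x \<sqsubseteq> c" "\<not> c \<sqsubseteq> x"
      using ord[rule_format, OF A(1) cA] ord[rule_format, OF cA A(1)] c[symmetric] \<open>f x < f y\<close>
      by simp_all
    show "c \<noteq> y" using c \<open>f x < f y\<close> by auto
  qed (use cA in auto)
qed

section \<open>Closed segments\<close>

lemma segment_iff:
  "c \<in> segment T a b \<longleftrightarrow> c \<in> carrier T \<and> a \<sqinter> b \<sqsubseteq> c \<and> (c \<sqsubseteq> a \<or> c \<sqsubseteq> b)"
  by (auto simp: segment_def)

lemma segment_commute: "segment T a b = segment T b a"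
  by (auto simp: segment_iff meet_def insert_commute)

lemma left_in_segment: "a \<in> carrier T \<Longrightarrow> b \<in> carrier T \<Longrightarrow> a \<in> segment T a b"
  by (simp add: segment_iff tree_meet_left)

lemma right_in_segment: "a \<in> carrier T \<Longrightarrow> b \<in> carrier T \<Longrightarrow> b \<in> segment T a b"
  by (simp add: segment_iff tree_meet_right)

lemma segment_same: "a \<in> carrier T \<Longrightarrow> segment T a a = {a}"
  by (auto simp: segment_iff tree_meet_left)
     (metis le_antisym le_trans tree_meet_closed tree_meet_greatest le_refl)

text \<open>The source of transitivity of the classes and of all later comparisons. If
  \<open>c\<close> on the leg towards \<open>a\<close> avoids both segments, then neither
  \<open>a \<sqinter> d\<close> nor \<open>d \<sqinter> b\<close> lies below \<open>c\<close>. Both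
  lie below \<open>d\<close>, so they are comparable, and the smaller one lies below
  \<open>a \<sqinter> b\<close>, hence below \<open>c\<close>.\<close>

lemma segment_triangle:
  assumes "a \<in> carrier T" "b \<in> carrier T" "d \<in> carrier T" "c \<in> segment T a b"
  shows "c \<in> segment T a d \<or> c \<in> segment T d b"
proof -
  have left: "c \<in> segment T a d \<or> c \<in> segment T d b"
    if "a \<in> carrier T" "b \<in> carrier T" "c \<in> carrier T" "a \<sqinter> b \<sqsubseteq> c" "c \<sqsubseteq> a" for a b
  proof (rule ccontr)
    note m = tree_meet_closed tree_meet_left tree_meet_right
    note C = that(1,2,3) assms(3)
    assume neg: "\<not> ?thesis"
    have ad: "\<not> a \<sqinter> d \<sqsubseteq> c" using neg that by (simp add: segment_iff)
    then have cad: "c \<sqsubseteq> a \<sqinter> d"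
      using down_set_total[of c "a \<sqinter> d" a] C m[of a d] that(5) by blast
    then have cd: "c \<sqsubseteq> d" using C m[of a d] le_trans by meson
    then have db: "\<not> d \<sqinter> b \<sqsubseteq> c" using neg C by (simp add: segment_iff)
    have "a \<sqinter> d \<sqsubseteq> d \<sqinter> b \<or> d \<sqinter> b \<sqsubseteq> a \<sqinter> d"
      using down_set_total[of "a \<sqinter> d" "d \<sqinter> b" d] C m[of a d] m[of d b] by blast
    then show False
    proof
      assume "a \<sqinter> d \<sqsubseteq> d \<sqinter> b"
      then have "a \<sqinter> d \<sqsubseteq> a \<sqinter> b"
        using C m le_trans tree_meet_greatest by meson
      then show False using ad that C m le_trans by meson
    next
      assume "d \<sqinter> b \<sqsubseteq> a \<sqinter> d"
      then have "d \<sqinter> b \<sqsubseteq> a \<sqinter> b"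
        using C m le_trans tree_meet_greatest by meson
      then show False using db that C m le_trans by meson
    qed
  qed
  have "c \<in> carrier T" "a \<sqinter> b \<sqsubseteq> c" "b \<sqinter> a \<sqsubseteq> c" "c \<sqsubseteq> a \<or> c \<sqsubseteq> b"
    using assms(4) by (auto simp: segment_iff meet_def insert_commute)
  then show ?thesis
    using left[of a b] left[of b a] assms segment_commute by blast
qed

text \<open>Since segments are symmetric, this is antisymmetry of the order based at
  \<open>y\<close>.\<close>

lemma segment_antisym:
  assumes "x \<in> carrier T" "y \<in> carrier T" "t \<in> carrier T"
    and "x \<in> segment T t y" "t \<in> segment T x y"
  shows "x = t"
  using assms unfolding segment_iff
  by (metis le_antisym le_trans tree_meet_closed tree_meet_greatest le_refl)

text \<open>
  The point \<open>c\<close> is taken strictly between \<open>s\<close> and the median of \<open>t\<close>, \<open>s\<close>, \<open>u\<close>.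
\<close>

lemma segment_escape:
  assumes "s \<in> carrier T" "t \<in> carrier T" "u \<in> carrier T" "s \<notin> segment T t u"
  obtains c where "c \<in> segment T t s" "c \<noteq> s" "c \<notin> segment T t u"
proof (cases "s \<sqsubseteq> t")
  case True
  note m = tree_meet_closed tree_meet_left tree_meet_right
  have "\<not> t \<sqinter> u \<sqsubseteq> s" using assms True by (simp add: segment_iff)
  then have "s \<sqsubseteq> t \<sqinter> u" "s \<noteq> t \<sqinter> u"
    using down_set_total[of s "t \<sqinter> u" t] assms m[of t u] True le_refl by auto
  \<comment> \<open>Here the median is \<open>t \<sqinter> u\<close>, and every point of the segment
    from \<open>t\<close> to \<open>u\<close> lies above it, so \<open>c\<close> is off that
    segment.\<close>
  then obtain c where c: "c \<in> carrier T" "s \<sqsubseteq> c" "c \<sqsubseteq> t \<sqinter> u" "\<not> c \<sqsubseteq> s" "c \<noteq> t \<sqinter> u"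
    using tree_dense[of s "t \<sqinter> u"] assms m by metis
  have "c \<in> segment T t s"
    using c assms m le_trans unfolding segment_iff by meson
  moreover have "c \<notin> segment T t u"
    using c assms m le_antisym unfolding segment_iff by meson
  moreover have "c \<noteq> s" using c assms by auto
  ultimately show thesis using that by blast
next
  case False
  note m = tree_meet_closed tree_meet_left tree_meet_right
  have su: "\<not> s \<sqsubseteq> u"
  proof
    assume "s \<sqsubseteq> u"
    then have "\<not> t \<sqinter> u \<sqsubseteq> s" using assms by (simp add: segment_iff)
    then have "s \<sqsubseteq> t \<sqinter> u"
      using down_set_total[of s "t \<sqinter> u" u] assms m[of t u] \<open>s \<sqsubseteq> u\<close> by blast
    then show False using False assms m le_trans by meson
  qed
  \<comment> \<open>\<open>n\<close> is the larger of the two meets, comparable because both lie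
    below \<open>s\<close>; it differs from \<open>s\<close> because \<open>s\<close> is below
    neither \<open>t\<close> nor \<open>u\<close>.\<close>
  obtain n where n: "n \<in> carrier T" "n \<sqsubseteq> s" "n \<noteq> s" "t \<sqinter> s \<sqsubseteq> n" "u \<sqinter> s \<sqsubseteq> n"
    using down_set_total[of "t \<sqinter> s" "u \<sqinter> s" s] False su assms m le_refl by metis
  obtain c where c: "c \<in> carrier T" "n \<sqsubseteq> c" "c \<sqsubseteq> s" "\<not> c \<sqsubseteq> n" "c \<noteq> s"
    using tree_dense[of n s] n assms by metis
  have "c \<in> segment T t s"
    using c n assms m le_trans unfolding segment_iff by meson
  \<comment> \<open>If \<open>c\<close> were below \<open>t\<close> or \<open>u\<close>, it would be
    below the corresponding meet with \<open>s\<close>, hence below \<open>n\<close>.\<close>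
  moreover have ctu: "\<not> c \<sqsubseteq> t" "\<not> c \<sqsubseteq> u"
    using c n assms m le_trans tree_meet_greatest by meson+
  moreover have "c \<notin> segment T t u"
    using ctu by (simp add: segment_iff)
  ultimately show thesis using that[of c] \<open>c \<noteq> s\<close> by simp
qed

section \<open>Classes at a point and their Scott openness\<close>

lemma tree_equiv_if_below:
  assumes "x \<in> carrier T" "y \<in> carrier T" "t \<in> carrier T" "x \<noteq> t" "x \<in> segment T t y"
  shows "(x, y) \<in> tree_equiv T t"
proof -
  have "t \<notin> segment T x y" using segment_antisym assms by blast
  moreover have "y \<noteq> t" using assms by (auto simp: segment_same)
  ultimately show ?thesis using assms by (simp add: tree_equiv_def)
qed

text \<open>If \<open>t\<close> lay between \<open>a\<close> and \<open>c\<close>, the triangle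
  property would place it between \<open>a\<close> and \<open>b\<close> or between \<open>b\<close>
  and \<open>c\<close>.\<close>

lemma tree_equiv_trans:
  assumes "t \<in> carrier T" "(a, b) \<in> tree_equiv T t" "(b, c) \<in> tree_equiv T t"
  shows "(a, c) \<in> tree_equiv T t"
  using assms segment_triangle[of a c b t] by (auto simp: tree_equiv_def)

lemma tree_equiv_sym: "(a, b) \<in> tree_equiv T t \<Longrightarrow> (b, a) \<in> tree_equiv T t"
  by (auto simp: tree_equiv_def segment_commute)

lemma scott_open_tree_equiv_class:
  assumes "a \<in> carrier T" "t \<in> carrier T" "a \<noteq> t"
  shows "scott_open (order_from T t) (tree_equiv T t `` {a})"
  unfolding scott_open_def upper_set_def inaccessible_by_directed_joins_def
proof (intro conjI ballI allI impI)
  show "tree_equiv T t `` {a} \<subseteq> carrier (order_from T t)"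
    by (auto simp: tree_equiv_def order_from_def)
next
  fix x y
  assume "x \<in> tree_equiv T t `` {a}" "y \<in> carrier (order_from T t)" "x \<sqsubseteq>\<^bsub>order_from T t\<^esub> y"
  then have "(a, x) \<in> tree_equiv T t" "y \<in> carrier T" "x \<in> segment T t y"
    by (auto simp: order_from_def)
  moreover from this have "x \<in> carrier T" "x \<noteq> t" by (auto simp: tree_equiv_def)
  ultimately show "y \<in> tree_equiv T t `` {a}"
    using tree_equiv_trans tree_equiv_if_below assms(2) by blast
next
  fix D s
  assume *: "directed_set (order_from T t) D \<and> is_lub (order_from T t) s D \<and>
    s \<in> tree_equiv T t `` {a}"
  have D: "D \<subseteq> carrier T" "D \<noteq> {}"
    using * by (auto simp: directed_set_def order_from_def)
  have up: "\<And>d. d \<in> D \<Longrightarrow> d \<in> segment T t s"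
    and least: "\<And>u. u \<in> carrier T \<Longrightarrow> (\<And>d. d \<in> D \<Longrightarrow> d \<in> segment T t u) \<Longrightarrow> s \<in> segment T t u"
    using * D by (auto simp: least_def Upper_def order_from_def)
  have s: "(a, s) \<in> tree_equiv T t" "s \<in> carrier T" "s \<noteq> t"
    using * by (auto simp: tree_equiv_def)
  \<comment> \<open>If \<open>D\<close> held nothing but \<open>t\<close>, then \<open>t\<close>
    would be an upper bound and the supremum \<open>s\<close> would lie on the degenerate segment
    from \<open>t\<close> to \<open>t\<close>.\<close>
  obtain d where d: "d \<in> D" "d \<noteq> t"
    using least[of t] s segment_same[of t] assms by auto
  then have "(d, s) \<in> tree_equiv T t"
    using tree_equiv_if_below up D s assms by blast
  then have "(a, d) \<in> tree_equiv T t"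
    using tree_equiv_trans tree_equiv_sym s assms by blast
  then show "D \<inter> tree_equiv T t `` {a} \<noteq> {}" using d by blast
qed

lemma openin_weak_tree_topology_class:
  assumes "a \<in> carrier T" "t \<in> carrier T" "a \<noteq> t"
  shows "openin (weak_tree_topology T) (tree_equiv T t `` {a})"
  unfolding weak_tree_topology_def topology_on_generated_by_def
  using assms by (intro topology_generated_by_Basis) blast

section \<open>Scott open sets are weakly open\<close>

lemma segment_total:
  assumes "x \<in> segment T t s" "y \<in> segment T t s" "s \<in> carrier T" "t \<in> carrier T"
  shows "x \<in> segment T t y \<or> y \<in> segment T t x"
proof (rule ccontr)
  assume neg: "\<not> ?thesis"
  have C: "x \<in> carrier T" "y \<in> carrier T" using assms by (auto simp: segment_iff)
  \<comment> \<open>Splitting the segment from \<open>t\<close> to \<open>s\<close> at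
    \<open>y\<close> and at \<open>x\<close> puts each point between the other and \<open>s\<close>;
    antisymmetry of the order based at \<open>s\<close> then identifies them.\<close>
  have "x \<in> segment T y s" "y \<in> segment T x s"
    using segment_triangle[of t s y x] segment_triangle[of t s x y] neg assms C by auto
  then have "x = y" using segment_antisym[of x s y] C assms by blast
  then show False using neg C assms by (simp add: right_in_segment)
qed

text \<open>Removing \<open>s\<close> leaves a chain containing \<open>t\<close>, hence a directed
  set. It has no upper bound \<open>u\<close> outside those above \<open>s\<close>, because
  \<open>segment_escape\<close> gives a point of the chain that is not below \<open>u\<close> in the
  order from \<open>t\<close>.\<close>

lemma is_lub_half_open_segment:
  assumes "s \<in> carrier T" "t \<in> carrier T" "s \<noteq> t"
  shows "directed_set (order_from T t) (segment T t s - {s})"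
    and "is_lub (order_from T t) s (segment T t s - {s})"
proof -
  let ?D = "segment T t s - {s}"
  have sub: "?D \<subseteq> carrier T" by (auto simp: segment_iff)
  have "\<exists>z\<in>?D. x \<in> segment T t z \<and> y \<in> segment T t z" if "x \<in> ?D" "y \<in> ?D" for x y
    using segment_total[of x t s y] that assms sub right_in_segment by blast
  moreover have "t \<in> ?D" using assms left_in_segment by blast
  ultimately show "directed_set (order_from T t) ?D"
    using sub by (auto simp: directed_set_def order_from_def)
  have "s \<in> segment T t u" if u: "u \<in> Upper (order_from T t) ?D" for u
  proof (rule ccontr)
    have *: "u \<in> carrier T" "\<And>d. d \<in> ?D \<Longrightarrow> d \<in> segment T t u"
      using u sub by (auto simp: Upper_def order_from_def)
    assume "s \<notin> segment T t u"
    then obtain c where "c \<in> segment T t s" "c \<noteq> s" "c \<notin> segment T t u"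
      using segment_escape assms(1,2) *(1) by metis
    then show False using *(2) by blast
  qed
  moreover have "s \<in> Upper (order_from T t) ?D"
    using assms(1) by (simp add: Upper_def order_from_def)
  moreover have "Upper (order_from T t) ?D \<subseteq> carrier (order_from T t)"
    by (rule Upper_closed)
  ultimately show "is_lub (order_from T t) s ?D"
    unfolding least_def by (simp add: order_from_def)
qed

lemma openin_weak_if_scott_open:
  assumes "t \<in> carrier T" "scott_open (order_from T t) U"
  shows "openin (weak_tree_topology T) U"
proof (subst openin_subopen, intro ballI)
  fix s assume s: "s \<in> U"
  have U: "U \<subseteq> carrier T"
    and up: "\<And>x y. x \<in> U \<Longrightarrow> y \<in> carrier T \<Longrightarrow> x \<in> segment T t y \<Longrightarrow> y \<in> U"
    and inacc: "inaccessible_by_directed_joins (order_from T t) U"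
    using assms(2) by (auto simp: scott_open_def upper_set_def order_from_def)
  have sT: "s \<in> carrier T" using s U by blast
  show "\<exists>V. openin (weak_tree_topology T) V \<and> s \<in> V \<and> V \<subseteq> U"
  \<comment> \<open>At the root the half-open segment is empty; instead \<open>t\<close> is the
    least element of its own order, so the upper set \<open>U\<close> is the whole tree.\<close>
  proof (cases "s = t")
    case True
    then have "carrier T \<subseteq> U" using up[OF s] left_in_segment assms(1) by blast
    moreover have "openin (weak_tree_topology T) (carrier T)"
      unfolding weak_tree_topology_def topology_on_generated_by_def
      by (intro topology_generated_by_Basis) blast
    ultimately show ?thesis using sT by blast
  next
    case False
    then have "(segment T t s - {s}) \<inter> U \<noteq> {}"
      using is_lub_half_open_segment[of s t] s sT assms(1) inacc
      unfolding inaccessible_by_directed_joins_def by blast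
    then obtain d where d: "d \<in> segment T t s" "d \<noteq> s" "d \<in> U" by blast
    have dT: "d \<in> carrier T" using d U by blast
    have "b \<in> U" if "b \<in> tree_equiv T d `` {s}" for b
    proof -
      have "b \<in> carrier T" "d \<notin> segment T b s"
        using that by (auto simp: tree_equiv_def segment_commute)
      \<comment> \<open>Splitting the segment from \<open>t\<close> to \<open>s\<close> at
        \<open>b\<close> leaves \<open>d\<close> between \<open>t\<close> and \<open>b\<close>, so
        \<open>b\<close> is above \<open>d\<close> in the order from \<open>t\<close>.\<close>
      then show ?thesis
        using segment_triangle[of t s b d] d sT assms(1) up by blast
    qed
    moreover have "s \<in> tree_equiv T d `` {s}"
      using d sT by (auto simp: tree_equiv_def segment_same)
    ultimately show ?thesis
      using openin_weak_tree_topology_class[of s d] d sT dT by blast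
  qed
qed

end

theorem theorem1p2:
  fixes T :: "('a, 'b) gorder_scheme"
  assumes "rooted_nonmetric_tree T"
  shows "weak_tree_topology T =
           topology_on_generated_by (carrier T)
             (\<Union>t\<in>carrier T. {U. openin (scott_topology (order_from T t)) U})"
proof -
  interpret rooted_nonmetric_tree T by (rule assms)
  show ?thesis
    unfolding weak_tree_topology_def
  proof (rule topology_on_generated_by_eqI)
    fix U assume "U \<in> {tree_equiv T t `` {a} | a t. a \<in> carrier T \<and> t \<in> carrier T \<and> a \<noteq> t}"
    then show "openin (topology_on_generated_by (carrier T)
        (\<Union>t\<in>carrier T. {U. openin (scott_topology (order_from T t)) U})) U"
      unfolding topology_on_generated_by_def openin_scott_topology
      using scott_open_tree_equiv_class by (intro topology_generated_by_Basis) blast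
  next
    fix U assume "U \<in> (\<Union>t\<in>carrier T. {U. openin (scott_topology (order_from T t)) U})"
    then obtain t where "t \<in> carrier T" "scott_open (order_from T t) U"
      by (auto simp: openin_scott_topology)
    then show "openin (topology_on_generated_by (carrier T)
        {tree_equiv T t `` {a} | a t. a \<in> carrier T \<and> t \<in> carrier T \<and> a \<noteq> t}) U"
      by (rule openin_weak_if_scott_open[unfolded weak_tree_topology_def])
  qed
qed

end
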